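(* Let $Q$ be the substitution on $\{0,1\}$ given by $Q(0)=0110$, $Q(1)=1001$ (the square of the Morse–Thue substitution), let $x\in\{0,1\}^{\mathbb Z}$ be any one of the four bi-infinite fixed points of $Q$, let $\sigma$ be the shift on $\{0,1\}^{\mathbb Z}$, and let $X=\overline{\{\sigma^n x: n\in\mathbb Z\}}$. Then the flow $(X,\sigma)$ (that is, the action of $\mathbb Z$ on $X$ generated by $\sigma$) satisfies $SP(X)=\Delta$; that is, $(X,\sigma)$ is weakly distal.
   Context: The substitution $Q$ acts on a bi-infinite sequence $x=\ldots x_{-2}x_{-1}.x_0x_1\ldots$ by $Q(x)=\ldots Q(x_{-2})Q(x_{-1}).Q(x_0)Q(x_1)\ldots$ (the dot immediately precedes the coordinate with index $0$). Its four bi-infinite fixed points are $a=\ldots 1001.1001\ldots$, $b=\ldots 0110.1001\ldots$, $\bar a=\ldots 0110.0110\ldots$, $\bar b=\ldots 1001.0110\ldots$; all four have the same shift-orbit closure. The shift is $(\sigma x)_n=x_{n+1}$. A flow $(X,T)$ is a jointly continuous left action of a topological group $T$ on a compact Hausdorff (in particular, compact metric) space $X$; here $T=\mathbb Z$. $T$ acts diagonally on $X\times X$, and $\Delta\subset X\times X$ is the diagonal. A point is almost periodic if its orbit closure is a minimal set (non-empty, closed, $T$-invariant, minimal with these properties). $\Omega(X)$ is the set of all almost periodic points of $(X\times X,T)$. The strongly proximal relation is $SP(X)=\{(x,y)\in X\times X:\overline{T(x,y)}\cap\Omega(X)\subset\Delta\}$. The flow is weakly distal if $SP(X)=\Delta$.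 *)

theory Defs
  imports "HOL-Analysis.Analysis"
begin

instance int :: topological_group_add
  by standard (simp add: nhds_discrete filterlim_principal eventually_principal)

lemma open_coordinate_vimage:
  fixes U :: "'b::topological_space set" and i :: 'a
  assumes "open U"
  shows "open ((\<lambda>z :: 'a \<Rightarrow> 'b. z i) -` U)"
  by (rule open_vimage[OF assms continuous_on_product_coordinates])

text \<open>The library has these instances only through metric spaces. \<open>bool\<close> is not an instance of
  \<^class>\<open>metric_space\<close>, and the classes have to be treated one after the other to remain
  compatible with the existing arities.\<close>

instance "fun" :: (type, t0_space) t0_space
proof
  fix x y :: "'a \<Rightarrow> 'b"
  assume "x \<noteq> y"
  then obtain i where "x i \<noteq> y i" by auto
  then obtain U where U: "open U" "\<not> (x i \<in> U \<longleftrightarrow> y i \<in> U)"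
    using t0_space_class.t0_space[OF \<open>x i \<noteq> y i\<close>] by blast
  then show "\<exists>U. open U \<and> \<not> (x \<in> U \<longleftrightarrow> y \<in> U)"
    by (intro exI[of _ "(\<lambda>z. z i) -` U"]) (auto simp: open_coordinate_vimage)
qed

instance "fun" :: (type, t1_space) t1_space
proof
  fix x y :: "'a \<Rightarrow> 'b"
  assume "x \<noteq> y"
  then obtain i where "x i \<noteq> y i" by auto
  then obtain U where U: "open U" "x i \<in> U" "y i \<notin> U"
    using t1_space_class.t1_space[OF \<open>x i \<noteq> y i\<close>] by blast
  then show "\<exists>U. open U \<and> x \<in> U \<and> y \<notin> U"
    by (intro exI[of _ "(\<lambda>z. z i) -` U"]) (auto simp: open_coordinate_vimage)
qed

instance "fun" :: (type, t2_space) t2_space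
proof
  fix x y :: "'a \<Rightarrow> 'b"
  assume "x \<noteq> y"
  then obtain i where "x i \<noteq> y i" by auto
  then obtain U V where UV: "open U" "open V" "x i \<in> U" "y i \<in> V" "U \<inter> V = {}"
    using hausdorff[OF \<open>x i \<noteq> y i\<close>] by blast
  then show "\<exists>U V. open U \<and> open V \<and> x \<in> U \<and> y \<in> V \<and> U \<inter> V = {}"
    by (intro exI[of _ "(\<lambda>z. z i) -` U"] exI[of _ "(\<lambda>z. z i) -` V"])
       (auto simp: open_coordinate_vimage)
qed

section \<open>Flows\<close>

text \<open>The acting group is written additively and need not be commutative. The phase space is a
  compact subset \<open>X\<close> of a Hausdorff space; such an \<open>X\<close> is closed, so closures of subsets of \<open>X\<close>
  (or of \<open>X \<times> X\<close>) taken in the ambient space agree with the closures taken in \<open>X\<close>.\<close>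

definition flow :: "('g::topological_group_add \<Rightarrow> 'x::t2_space \<Rightarrow> 'x) \<Rightarrow> 'x set \<Rightarrow> bool" where
  "flow act X \<longleftrightarrow>
     compact X \<and>
     (\<forall>g. \<forall>x\<in>X. act g x \<in> X) \<and>
     (\<forall>x\<in>X. act 0 x = x) \<and>
     (\<forall>g h. \<forall>x\<in>X. act (g + h) x = act g (act h x)) \<and>
     continuous_on (UNIV \<times> X) (\<lambda>(g, x). act g x)"

definition act_orbit :: "('g \<Rightarrow> 'x \<Rightarrow> 'x) \<Rightarrow> 'x \<Rightarrow> 'x set" where
  "act_orbit act x = range (\<lambda>g. act g x)"

definition diag_act :: "('g \<Rightarrow> 'x \<Rightarrow> 'x) \<Rightarrow> 'g \<Rightarrow> 'x \<times> 'x \<Rightarrow> 'x \<times> 'x" where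
  "diag_act act g z = (act g (fst z), act g (snd z))"

definition closed_invariant :: "('g \<Rightarrow> 'x::topological_space \<Rightarrow> 'x) \<Rightarrow> 'x set \<Rightarrow> bool" where
  "closed_invariant act M \<longleftrightarrow> M \<noteq> {} \<and> closed M \<and> (\<forall>g. \<forall>x\<in>M. act g x \<in> M)"

definition minimal_set :: "('g \<Rightarrow> 'x::topological_space \<Rightarrow> 'x) \<Rightarrow> 'x set \<Rightarrow> bool" where
  "minimal_set act M \<longleftrightarrow>
     closed_invariant act M \<and> (\<forall>N. N \<subseteq> M \<and> closed_invariant act N \<longrightarrow> N = M)"

definition almost_periodic :: "('g \<Rightarrow> 'x::topological_space \<Rightarrow> 'x) \<Rightarrow> 'x \<Rightarrow> bool" where
  "almost_periodic act x \<longleftrightarrow> minimal_set act (closure (act_orbit act x))"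

definition Omega :: "('g \<Rightarrow> 'x::topological_space \<Rightarrow> 'x) \<Rightarrow> 'x set \<Rightarrow> ('x \<times> 'x) set" where
  "Omega act X = {z \<in> X \<times> X. almost_periodic (diag_act act) z}"

definition SP :: "('g \<Rightarrow> 'x::topological_space \<Rightarrow> 'x) \<Rightarrow> 'x set \<Rightarrow> ('x \<times> 'x) set" where
  "SP act X = {z \<in> X \<times> X. closure (act_orbit (diag_act act) z) \<inter> Omega act X \<subseteq> Id_on X}"

definition weakly_distal :: "('g \<Rightarrow> 'x::topological_space \<Rightarrow> 'x) \<Rightarrow> 'x set \<Rightarrow> bool" where
  "weakly_distal act X \<longleftrightarrow> SP act X = Id_on X"

section \<open>The shift and the substitution\<close>

text \<open>The letters 0 and 1 are \<^const>\<open>False\<close> and \<^const>\<open>True\<close>; \<^typ>\<open>int \<Rightarrow> bool\<close> carries the product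
  of the discrete topologies.\<close>

definition shift :: "(int \<Rightarrow> bool) \<Rightarrow> int \<Rightarrow> bool" where
  "shift x = (\<lambda>n. x (n + 1))"

definition int_act :: "('x \<Rightarrow> 'x) \<Rightarrow> int \<Rightarrow> 'x \<Rightarrow> 'x" where
  "int_act f n = (if 0 \<le> n then f ^^ nat n else inv f ^^ nat (- n))"

definition Q :: "bool \<Rightarrow> bool list" where
  "Q c = (if c then [True, False, False, True] else [False, True, True, False])"

text \<open>Since \<open>Q\<close> has constant length 4 and the image of the letter at index 0 starts at index 0, the
  block \<open>Q (x m)\<close> occupies the indices \<open>4 m, \<dots>, 4 m + 3\<close>; \<open>div\<close> and \<open>mod\<close> on
  \<^typ>\<open>int\<close> round towards minus infinity, as needed for negative indices.\<close>

definition Q_seq :: "(int \<Rightarrow> bool) \<Rightarrow> int \<Rightarrow> bool" where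
  "Q_seq x n = Q (x (n div 4)) ! nat (n mod 4)"

lemma inv_shift: "inv shift x = (\<lambda>n. x (n - 1))"
proof (rule inv_f_eq)
  show "inj shift"
  proof (rule injI, rule ext)
    fix x y n assume "shift x = shift y"
    then have "shift x (n - 1) = shift y (n - 1)" by simp
    then show "x n = y n" by (simp add: shift_def)
  qed
qed (simp add: shift_def)

lemma int_act_shift: "int_act shift n x k = x (k + n)"
proof -
  have pos: "(shift ^^ m) x k = x (k + int m)" for m k
    by (induction m arbitrary: k) (simp_all add: shift_def algebra_simps)
  have neg: "(inv shift ^^ m) x k = x (k - int m)" for m k
    by (induction m arbitrary: k) (simp_all add: inv_shift algebra_simps)
  show ?thesis by (simp add: int_act_def pos neg)
qed

end

theory Submission
  imports Defs
begin

text \<open>The sequences in \<open>X\<close> carry a nested system of cuttings into blocks of length \<open>2 ^ k\<close>, and the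
  position of the cuts is unique modulo \<open>2 ^ k\<close>. If the cuts of two sequences \<open>y \<noteq> z\<close> in \<open>X\<close> differ
  at some level, the difference persists in the whole orbit closure of \<open>(y, z)\<close>, which therefore
  misses the diagonal. If they agree at all levels, then \<open>y\<close> and \<open>z\<close> are complementary on
  arbitrarily long blocks, so the orbit closure contains a pair of complementary sequences.
  Either way it contains a closed invariant set off the diagonal, and Zorn's lemma gives a minimal
  set, hence an almost periodic point, inside that set.\<close>

section \<open>Minimal sets\<close>

lemma closed_invariant_closure_orbit:
  fixes act :: "'g::group_add \<Rightarrow> 'x::topological_space \<Rightarrow> 'x"
  assumes cont: "\<And>g. continuous_on UNIV (act g)"
    and add: "\<And>g h x. act (g + h) x = act g (act h x)"
  shows "closed_invariant act (closure (act_orbit act x))"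
proof -
  have "act g ` closure (act_orbit act x) \<subseteq> closure (act_orbit act x)" for g
  proof (rule image_closure_subset)
    show "continuous_on (closure (act_orbit act x)) (act g)"
      using cont by (rule continuous_on_subset) simp
    have "act g (act h x) \<in> act_orbit act x" for h
      unfolding act_orbit_def add[symmetric] by blast
    then have "act g ` act_orbit act x \<subseteq> act_orbit act x"
      unfolding act_orbit_def by blast
    then show "act g ` act_orbit act x \<subseteq> closure (act_orbit act x)"
      using closure_subset by blast
  qed simp
  moreover have "closure (act_orbit act x) \<noteq> {}"
    by (simp add: act_orbit_def)
  ultimately show ?thesis
    by (auto simp: closed_invariant_def)
qed

lemma compact_contains_minimal_set:
  fixes act :: "'g \<Rightarrow> 'x::topological_space \<Rightarrow> 'x"
  assumes "compact N" "closed_invariant act N"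
  obtains M where "M \<subseteq> N" "minimal_set act M"
proof -
  \<comment> \<open>Complements turn minimal closed invariant subsets of \<open>N\<close> into
    maximal elements of \<open>?A\<close>, the form in which Zorn's lemma delivers them.\<close>
  let ?A = "{U. closed_invariant act (- U) \<and> - U \<subseteq> N}"
  have "- N \<in> ?A" using assms(2) by simp
  then have ne: "?A \<noteq> {}" by (metis empty_iff)
  have Un: "\<Union>\<C> \<in> ?A" if C0: "\<C> \<noteq> {}" and chain: "subset.chain ?A \<C>" for \<C>
  proof -
    have C: "closed_invariant act (- U)" "- U \<subseteq> N" if "U \<in> \<C>" for U
      using chain that by (auto simp: subset.chain_def)
    have opn: "open U" if "U \<in> \<C>" for U
      using C(1)[OF that] by (simp add: closed_invariant_def closed_def)
    \<comment> \<open>If the chain covered \<open>N\<close>, compactness would leave a finite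
      subchain covering \<open>N\<close>. Its union is one of its members, whose complement would be
      empty, against membership in \<open>?A\<close>.\<close>
    have "- \<Union>\<C> \<noteq> {}"
    proof
      assume "- \<Union>\<C> = {}"
      then have "N \<subseteq> \<Union>\<C>" by blast
      then obtain D where D: "D \<subseteq> \<C>" "finite D" "N \<subseteq> \<Union>D"
        using compactE[OF assms(1)] opn by metis
      have "D \<noteq> {}" using D(3) assms(2) by (auto simp: closed_invariant_def)
      moreover have "subset.chain ?A D"
        using D(1) chain unfolding subset.chain_def by blast
      ultimately have "\<Union>D \<in> D"
        using D(2) by (intro Union_in_chain)
      then have "\<Union>D \<in> \<C>" using D(1) by (rule rev_subsetD)
      then have "closed_invariant act (- \<Union>D)" "- \<Union>D \<subseteq> N" using C by simp_all
      moreover have "- A = {}" if "- A \<subseteq> N" "N \<subseteq> A" for A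
        using that by blast
      ultimately show False using D(3) by (simp add: closed_invariant_def)
    qed
    moreover have "closed (- \<Union>\<C>)" using opn by (simp add: closed_def open_Union)
    moreover have "act g x \<in> - \<Union>\<C>" if "x \<in> - \<Union>\<C>" for g x
      using C(1) that unfolding closed_invariant_def by blast
    moreover have "- \<Union>\<C> \<subseteq> N" using C0 C(2) by blast
    ultimately show ?thesis by (simp add: closed_invariant_def)
  qed
  have "\<exists>U\<in>?A. \<forall>V\<in>?A. U \<subseteq> V \<longrightarrow> V = U"
    using ne Un by (rule subset_Zorn_nonempty)
  then obtain U where U: "U \<in> ?A" "\<forall>V\<in>?A. U \<subseteq> V \<longrightarrow> V = U"
    by (rule bexE)
  from U(1) have U1: "closed_invariant act (- U)" "- U \<subseteq> N" by simp_all
  have "minimal_set act (- U)"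
    unfolding minimal_set_def
  proof (intro conjI allI impI)
    show "closed_invariant act (- U)" by (rule U1)
    fix K assume K: "K \<subseteq> - U \<and> closed_invariant act K"
    then have "K \<subseteq> N" using U1(2) by (metis subset_trans)
    with K have "- K \<in> ?A" by simp
    moreover have "U \<subseteq> - K" using conjunct1[OF K] by (metis compl_le_swap1)
    ultimately have "- K = U" by (rule U(2)[rule_format])
    then show "K = - U" by (metis double_complement)
  qed
  with U1(2) show ?thesis by (rule that)
qed

text \<open>The orbit closure is a closed invariant subset of \<open>M\<close>, so minimality makes
  it all of \<open>M\<close>.\<close>

lemma minimal_set_almost_periodic:
  fixes act :: "'g::group_add \<Rightarrow> 'x::topological_space \<Rightarrow> 'x"
  assumes "\<And>g. continuous_on UNIV (act g)"
    and "\<And>g h x. act (g + h) x = act g (act h x)"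
    and "minimal_set act M" "x \<in> M"
  shows "almost_periodic act x"
proof -
  have "act_orbit act x \<subseteq> M" "closed M"
    using assms(3,4) by (auto simp: minimal_set_def closed_invariant_def act_orbit_def)
  then have "closure (act_orbit act x) \<subseteq> M" by (rule closure_minimal)
  with closed_invariant_closure_orbit[of act x, OF assms(1,2)] assms(3)
  have "closure (act_orbit act x) = M"
    unfolding minimal_set_def by blast
  with assms(3) show ?thesis by (simp add: almost_periodic_def)
qed

section \<open>The shift flow\<close>

lemma compact_UNIV_bool_sequences: "compact (UNIV :: ('a \<Rightarrow> bool) set)"
proof -
  have "compact_space (product_topology (\<lambda>i::'a. euclidean :: bool topology) UNIV)"
    unfolding compact_space_product_topology by (simp add: compact_space_def finite_imp_compact)
  then show ?thesis
    unfolding euclidean_product_topology compact_space_def by simp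
qed

text \<open>All subsets of the discrete space \<open>bool\<close> are closed, so disagreement
  survives limits just as agreement does.\<close>

lemma closed_Collect_neq_bool:
  fixes f g :: "'a::topological_space \<Rightarrow> bool"
  assumes "continuous_on UNIV f" "continuous_on UNIV g"
  shows "closed {z. f z \<noteq> g z}"
proof -
  have "closed (f -` A)" "closed (g -` A)" for A
    using assms by (auto intro!: closed_vimage simp: closed_def open_discrete)
  moreover have "{z. f z \<noteq> g z} =
      f -` {True} \<inter> g -` {False} \<union> f -` {False} \<inter> g -` {True}"
    by auto
  ultimately show ?thesis by auto
qed

lemma closed_pairs_differing_at: "closed {w :: ('a \<Rightarrow> bool) \<times> ('a \<Rightarrow> bool). fst w i \<noteq> snd w i}"
proof (rule closed_Collect_neq_bool)
  have ev: "continuous_on UNIV (\<lambda>u :: 'a \<Rightarrow> bool. u i)"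
    by (rule continuous_on_product_coordinates)
  show "continuous_on UNIV (\<lambda>w :: ('a \<Rightarrow> bool) \<times> ('a \<Rightarrow> bool). fst w i)"
    by (rule continuous_on_compose2[OF ev continuous_on_fst[OF continuous_on_id]]) simp
  show "continuous_on UNIV (\<lambda>w :: ('a \<Rightarrow> bool) \<times> ('a \<Rightarrow> bool). snd w i)"
    by (rule continuous_on_compose2[OF ev continuous_on_snd[OF continuous_on_id]]) simp
qed

lemma int_act_shift_add:
  "int_act shift (g + h) x = int_act shift g (int_act shift h x)"
  by (rule ext) (simp add: int_act_shift algebra_simps)

lemma int_act_shift_0: "int_act shift 0 x = x"
  by (rule ext) (simp add: int_act_shift)

lemma continuous_on_int_act_shift: "continuous_on UNIV (int_act shift g)"
  by (rule continuous_on_coordinatewise_then_product)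
    (simp add: int_act_shift continuous_on_product_coordinates)

lemma continuous_on_diag_act:
  assumes "continuous_on UNIV (act g)"
  shows "continuous_on UNIV (diag_act act g)"
proof -
  have "continuous_on UNIV (\<lambda>z. act g (fst z))"
    by (rule continuous_on_compose2[OF assms continuous_on_fst[OF continuous_on_id]]) simp
  moreover have "continuous_on UNIV (\<lambda>z. act g (snd z))"
    by (rule continuous_on_compose2[OF assms continuous_on_snd[OF continuous_on_id]]) simp
  ultimately show ?thesis
    unfolding diag_act_def by (rule continuous_on_Pair)
qed

lemma diag_act_add:
  assumes "\<And>g h x. act (g + h) x = act g (act h x)"
  shows "diag_act act (g + h) z = diag_act act g (diag_act act h z)"
  by (simp add: diag_act_def assms)

lemmas continuous_on_diag_shift =
  continuous_on_diag_act[of "int_act shift", OF continuous_on_int_act_shift]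
lemmas diag_shift_add = diag_act_add[of "int_act shift", OF int_act_shift_add]

lemma flow_shift:
  assumes "closed X" "\<And>g x. x \<in> X \<Longrightarrow> int_act shift g x \<in> X"
  shows "flow (int_act shift) X"
proof -
  have "continuous_on UNIV (\<lambda>(g, x). int_act shift g x)"
  proof (rule continuous_on_coordinatewise_then_product)
    fix k :: int
    let ?f = "\<lambda>p :: int \<times> (int \<Rightarrow> bool). (case p of (g, x) \<Rightarrow> int_act shift g x) k"
    show "continuous_on UNIV ?f"
      unfolding continuous_on_open_vimage[OF open_UNIV]
    proof (intro allI impI)
      fix U :: "bool set"
      \<comment> \<open>Singletons of the discrete group are open, so joint continuity reduces to
        continuity of each coordinate: the preimage is a union of open rectangles.\<close>
      have "?f -` U \<inter> UNIV = (\<Union>g. {g} \<times> (\<lambda>x. x (k + g)) -` U)"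
        by (rule set_eqI) (simp add: int_act_shift case_prod_beta mem_Times_iff)
      moreover assume "open U"
      ultimately show "open (?f -` U \<inter> UNIV)"
        by (simp only:) (intro open_UN ballI open_Times open_coordinate_vimage open_discrete)
    qed
  qed
  moreover have "compact X"
    using compact_Int_closed[OF compact_UNIV_bool_sequences assms(1)] by simp
  ultimately show ?thesis
    unfolding flow_def
    by (simp add: assms(2) int_act_shift_0 int_act_shift_add continuous_on_subset[OF _ subset_UNIV])
qed

lemma closure_diag_orbit_subset:
  assumes "closed X" "\<And>g x. x \<in> X \<Longrightarrow> int_act shift g x \<in> X" "y \<in> X" "z \<in> X"
  shows "closure (act_orbit (diag_act (int_act shift)) (y, z)) \<subseteq> X \<times> X"
  using assms by (intro closure_minimal closed_Times) (auto simp: act_orbit_def diag_act_def)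

text \<open>No almost periodic pair has to be exhibited: a minimal subset of the compact set
  \<open>N\<close> supplies one off the diagonal, which excludes \<open>(y, z)\<close> from
  \<open>SP\<close>.\<close>

lemma weakly_distal_shiftI:
  assumes X: "closed X" "\<And>g x. x \<in> X \<Longrightarrow> int_act shift g x \<in> X"
    and off: "\<And>y z. y \<in> X \<Longrightarrow> z \<in> X \<Longrightarrow> y \<noteq> z \<Longrightarrow>
      \<exists>N. closed_invariant (diag_act (int_act shift)) N \<and> N \<inter> Id = {} \<and>
          N \<subseteq> closure (act_orbit (diag_act (int_act shift)) (y, z))"
  shows "weakly_distal (int_act shift) X"
proof -
  let ?O = "\<lambda>z. closure (act_orbit (diag_act (int_act shift)) z)"
  have "(y, z) \<notin> SP (int_act shift) X" if yz: "y \<in> X" "z \<in> X" "y \<noteq> z" for y z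
  proof -
    obtain N where N: "closed_invariant (diag_act (int_act shift)) N" "N \<inter> Id = {}" "N \<subseteq> ?O (y, z)"
      using off[OF yz] by blast
    have "compact (UNIV \<times> UNIV :: ((int \<Rightarrow> bool) \<times> (int \<Rightarrow> bool)) set)"
      by (intro compact_Times compact_UNIV_bool_sequences)
    with N(1) have "compact N"
      by (metis UNIV_Times_UNIV Int_UNIV_left compact_Int_closed closed_invariant_def)
    then obtain M where M: "M \<subseteq> N" "minimal_set (diag_act (int_act shift)) M"
      using compact_contains_minimal_set N(1) by metis
    then obtain p where p: "p \<in> M"
      by (auto simp: minimal_set_def closed_invariant_def)
    have "almost_periodic (diag_act (int_act shift)) p"
      by (intro minimal_set_almost_periodic[OF _ _ M(2) p] continuous_on_diag_shift diag_shift_add)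
    moreover have "p \<in> ?O (y, z)" "p \<notin> Id" using p M(1) N by auto
    moreover have "?O (y, z) \<subseteq> X \<times> X" using X yz by (intro closure_diag_orbit_subset)
    ultimately show ?thesis by (auto simp: SP_def Omega_def)
  qed
  \<comment> \<open>The diagonal is closed and invariant, so orbit closures of diagonal pairs never
    leave it.\<close>
  moreover have "(y, y) \<in> SP (int_act shift) X" if "y \<in> X" for y
  proof -
    have "?O (y, y) \<subseteq> {p. fst p = snd p}"
      by (intro closure_minimal closed_Collect_eq continuous_intros)
        (auto simp: act_orbit_def diag_act_def)
    with closure_diag_orbit_subset[OF X that that] that show ?thesis
      unfolding SP_def Id_on_iff by fastforce
  qed
  ultimately show ?thesis
    by (force simp: weakly_distal_def SP_def)
qed

section \<open>Dyadic block structure\<close>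

text \<open>A sequence with this property is a concatenation of blocks of length \<open>2 ^ k\<close>, starting at the
  indices congruent to \<open>m\<close>, each of which is the \<open>k\<close>-th Morse--Thue word or its complement.\<close>

definition dyadic_blocks :: "nat \<Rightarrow> int \<Rightarrow> (int \<Rightarrow> bool) \<Rightarrow> bool" where
  "dyadic_blocks k m y \<longleftrightarrow>
     (\<forall>l<k. \<forall>n. (n - m) mod 2 ^ (l + 1) < 2 ^ l \<longrightarrow> y (n + 2 ^ l) = (\<not> y n))"

lemma dyadic_blocksD:
  assumes "dyadic_blocks k m y" "l < k" "(n - m) mod 2 ^ (l + 1) < 2 ^ l"
  shows "y (n + 2 ^ l) = (\<not> y n)"
  using assms unfolding dyadic_blocks_def by blast

lemma dyadic_blocks_mono: "dyadic_blocks k m y \<Longrightarrow> l \<le> k \<Longrightarrow> dyadic_blocks l m y"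
  by (auto simp: dyadic_blocks_def)

text \<open>Level \<open>l < k\<close> sees the offset only modulo \<open>2 ^ (l + 1)\<close>, a
  divisor of \<open>2 ^ k\<close>; so only its residue class modulo \<open>2 ^ k\<close>
  matters.\<close>

lemma dyadic_blocks_cong_imp:
  assumes "dyadic_blocks k m y" "2 ^ k dvd m - m'"
  shows "dyadic_blocks k m' y"
  unfolding dyadic_blocks_def
proof (intro allI impI)
  fix l :: nat and n :: int
  assume l: "l < k" and n: "(n - m') mod 2 ^ (l + 1) < 2 ^ l"
  have "(2::int) ^ (l + 1) dvd 2 ^ k" using l by (intro le_imp_power_dvd) simp
  then have "2 ^ (l + 1) dvd (n - m') - (n - m)" using assms(2) by (auto intro: dvd_trans)
  then have "(n - m) mod 2 ^ (l + 1) = (n - m') mod 2 ^ (l + 1)"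
    by (metis mod_eq_dvd_iff)
  with n assms(1) l show "y (n + 2 ^ l) = (\<not> y n)"
    by (intro dyadic_blocksD[of k m]) auto
qed

lemma dyadic_blocks_shift:
  "dyadic_blocks k m (int_act shift s y) \<longleftrightarrow> dyadic_blocks k (m + s) y"
proof
  assume *: "dyadic_blocks k m (int_act shift s y)"
  show "dyadic_blocks k (m + s) y"
    unfolding dyadic_blocks_def
  proof (intro allI impI)
    fix l n assume "l < k" "(n - (m + s)) mod 2 ^ (l + 1) < 2 ^ l"
    then show "y (n + 2 ^ l) = (\<not> y n)"
      using dyadic_blocksD[OF *, of l "n - s"] by (simp add: int_act_shift algebra_simps)
  qed
next
  assume *: "dyadic_blocks k (m + s) y"
  show "dyadic_blocks k m (int_act shift s y)"
    unfolding dyadic_blocks_def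
  proof (intro allI impI)
    fix l n assume "l < k" "(n - m) mod 2 ^ (l + 1) < 2 ^ l"
    then show "int_act shift s y (n + 2 ^ l) = (\<not> int_act shift s y n)"
      using dyadic_blocksD[OF *, of l "n + s"] by (simp add: int_act_shift algebra_simps)
  qed
qed

lemma closed_dyadic_blocks: "closed {y. dyadic_blocks k m y}"
proof -
  have "{y. dyadic_blocks k m y} =
    (\<Inter>l\<in>{..<k}. \<Inter>n\<in>{n. (n - m) mod 2 ^ (l + 1) < 2 ^ l}. {y. y (n + 2 ^ l) \<noteq> y n})"
    by (auto simp: dyadic_blocks_def)
  also have "closed \<dots>"
    by (intro closed_INT ballI closed_Collect_neq_bool continuous_on_product_coordinates)
  finally show ?thesis .
qed

text \<open>If \<open>m\<close> and \<open>m'\<close> first differed modulo \<open>2 ^ Suc k\<close>, then \<open>y\<close> would alternate along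
  \<open>m + 2 ^ k \<int>\<close>, whereas the blocks of length \<open>2 ^ (k + 2)\<close> contain equal neighbours there.\<close>

lemma dyadic_blocks_unique:
  assumes ex: "\<And>k. \<exists>m. dyadic_blocks k m y"
    and "dyadic_blocks k m y" "dyadic_blocks k m' y"
  shows "2 ^ k dvd m - m'"
  using assms(2,3)
proof (induction k arbitrary: m m')
  case 0
  then show ?case by simp
next
  case (Suc k)
  have alt: "y (n + 2 ^ k) = (\<not> y n)" if "dyadic_blocks (Suc k) i y" "2 ^ Suc k dvd n - i" for n i
    using that by (intro dyadic_blocksD[of "Suc k" i]) (auto simp: dvd_eq_mod_eq_0)
  show ?case
  proof (rule ccontr)
    assume neq: "\<not> 2 ^ Suc k dvd m - m'"
    obtain i where i: "dyadic_blocks (k + 2) i y" using ex by blast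
    \<comment> \<open>\<open>n\<close> starts the second quarter of the block of length
      \<open>2 ^ (k + 2)\<close> at \<open>i\<close>, and the third quarter, at
      \<open>n + 2 ^ k\<close>, starts with the same letter. Since \<open>m\<close> and
      \<open>m'\<close> agree with \<open>i\<close> modulo \<open>2 ^ k\<close> but not with each
      other modulo \<open>2 ^ Suc k\<close>, one of them is congruent to \<open>n\<close> and forces
      opposite letters there.\<close>
    define n where "n = i + 2 ^ k"
    have "dyadic_blocks k j y" if "dyadic_blocks (Suc k) j y \<or> dyadic_blocks (k + 2) j y" for j
      using that by (auto intro: dyadic_blocks_mono)
    then have "2 ^ k dvd i - m" "2 ^ k dvd i - m'"
      using Suc.IH i Suc.prems by blast+
    then obtain a b where a: "i = m + 2 ^ k * a" and b: "i = m' + 2 ^ k * b"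
      by (metis dvd_def add.commute diff_add_cancel)
    have "m - m' = 2 ^ k * (b - a)" using a b by (simp add: algebra_simps)
    with neq have "\<not> 2 dvd b - a" by (auto simp: dvd_def)
    then have "2 dvd a + 1 \<or> 2 dvd b + 1" by presburger
    moreover have "n - m = 2 ^ k * (a + 1)" "n - m' = 2 ^ k * (b + 1)"
      using a b by (simp_all add: n_def algebra_simps)
    ultimately have "2 ^ Suc k dvd n - m \<or> 2 ^ Suc k dvd n - m'"
      by (auto simp: mult.commute)
    then have "y (n + 2 ^ k) = (\<not> y n)" using alt Suc.prems by blast
    moreover have "y n = (\<not> y i)"
      unfolding n_def by (intro dyadic_blocksD[OF i]) auto
    moreover have "y (i + 2 ^ Suc k) = (\<not> y i)"
      by (intro dyadic_blocksD[OF i]) auto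
    ultimately show False by (simp add: n_def algebra_simps)
  qed
qed

text \<open>Passing from the first half of a common block to the second complements both sequences,
  which preserves whether they agree. Hence they agree everywhere or nowhere on each block of length
  \<open>2 ^ k\<close>.\<close>

lemma same_blocks_agree_iff:
  assumes "dyadic_blocks k m y" "dyadic_blocks k m z"
  shows "y n = z n \<longleftrightarrow>
    y (m + 2 ^ k * ((n - m) div 2 ^ k)) = z (m + 2 ^ k * ((n - m) div 2 ^ k))"
  using assms
proof (induction k)
  case 0
  then show ?case by simp
next
  case (Suc k)
  define q where "q = (n - m) div 2 ^ Suc k"
  define r where "r = (n - m) div 2 ^ k"
  have "r div 2 = q"
    unfolding q_def r_def by (simp add: zdiv_zmult2_eq[symmetric] mult.commute)
  \<comment> \<open>The block of length \<open>2 ^ k\<close> containing \<open>n\<close> is the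
    first or the second half of the one of length \<open>2 ^ Suc k\<close>.\<close>
  then have "r = 2 * q \<or> r = 2 * q + 1" by presburger
  then have "m + 2 ^ k * r = m + 2 ^ Suc k * q \<or> m + 2 ^ k * r = m + 2 ^ Suc k * q + 2 ^ k"
    by (auto simp: algebra_simps)
  moreover have "w (m + 2 ^ Suc k * q + 2 ^ k) = (\<not> w (m + 2 ^ Suc k * q))"
    if "dyadic_blocks (Suc k) m w" for w
    by (rule dyadic_blocksD[OF that]) auto
  moreover have "y n = z n \<longleftrightarrow> y (m + 2 ^ k * r) = z (m + 2 ^ k * r)"
    unfolding r_def using Suc by (intro Suc.IH) (auto intro: dyadic_blocks_mono)
  ultimately show ?case unfolding q_def[symmetric] using Suc.prems by metis
qed

section \<open>The Morse--Thue flow\<close>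

text \<open>\<open>Q\<close> is the square of the Morse--Thue substitution, so it accounts for two
  dyadic levels at once. Levels 0 and 1 are read off the words \<open>Q c\<close>; level
  \<open>j + 2\<close> descends to level \<open>j\<close> at \<open>n div 4\<close>, because
  \<open>Q\<close> sends complementary letters to complementary words.\<close>

lemma Q_seq_fixed_dyadic_blocks:
  assumes "Q_seq x = x"
  shows "dyadic_blocks k 0 x"
proof -
  have Qx: "x n = Q (x (n div 4)) ! nat (n mod 4)" for n
    using assms by (metis Q_seq_def)
  have "x (n + 2 ^ l) = (\<not> x n)" if "n mod 2 ^ (l + 1) < 2 ^ l" for l n
    using that
  proof (induction l arbitrary: n rule: less_induct)
    case (less l)
    consider "l = 0" | "l = 1" | j where "l = j + 2"
      by (metis One_nat_def Suc_eq_plus1 add_2_eq_Suc' not0_implies_Suc)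
    then show ?case
    proof cases
      case 1
      with less.prems have "n mod 2 = 0" using pos_mod_sign[of 2 n] by simp
      then obtain q where "n = 2 * (2 * q) \<or> n = 2 * (2 * q + 1)"
        by (metis evenE oddE even_iff_mod_2_eq_zero)
      then have "n = 4 * q \<or> n = 4 * q + 2" by auto
      then show ?thesis
        unfolding 1 using Qx[of n] Qx[of "n + 1"]
        by (elim disjE) (simp_all add: Q_def numeral_eq_Suc)
    next
      case 2
      then have "n mod 4 < 2" using less.prems by simp
      moreover have "0 \<le> n mod 4" by simp
      ultimately have "n mod 4 = 0 \<or> n mod 4 = 1" by linarith
      moreover define q where "q = n div 4"
      moreover have "n = 4 * (n div 4) + n mod 4" by simp
      ultimately have "n = 4 * q \<or> n = 4 * q + 1" by linarith
      then show ?thesis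
        unfolding 2 using Qx[of n] Qx[of "n + 2"]
        by (elim disjE) (simp_all add: Q_def numeral_eq_Suc)
    next
      case 3
      \<comment> \<open>Adding \<open>2 ^ (j + 2)\<close> moves \<open>n div 4\<close> by
        \<open>2 ^ j\<close> and fixes \<open>n mod 4\<close>; this identity transfers the residue
        condition to \<open>n div 4\<close>.\<close>
      have "n mod (4 * 2 ^ (j + 1)) = 4 * ((n div 4) mod 2 ^ (j + 1)) + n mod 4"
        by (rule zmod_zmult2_eq) simp
      with less.prems have "(n div 4) mod 2 ^ (j + 1) < 2 ^ j"
        unfolding 3 by (simp add: power_add)
      then have "x (n div 4 + 2 ^ j) = (\<not> x (n div 4))"
        using less.IH[of j "n div 4"] 3 by simp
      moreover have "Q (\<not> c) ! nat (n mod 4) = (\<not> Q c ! nat (n mod 4))" for c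
      proof -
        have "n mod 4 = 0 \<or> n mod 4 = 1 \<or> n mod 4 = 2 \<or> n mod 4 = 3" by presburger
        then show ?thesis by (auto simp: Q_def numeral_eq_Suc)
      qed
      moreover have "(n + 2 ^ l) div 4 = n div 4 + 2 ^ j" "(n + 2 ^ l) mod 4 = n mod 4"
        unfolding 3 by (simp_all add: power_add)
      ultimately show ?thesis
        using Qx[of n] Qx[of "n + 2 ^ l"] by simp
    qed
  qed
  then show ?thesis by (simp add: dyadic_blocks_def)
qed

text \<open>Offsets may be taken in a finite range, so the sequences having some offset form a
  finite union of closed sets, which contains the orbit closure once it contains the orbit.\<close>

lemma orbit_closure_dyadic_blocks:
  assumes "Q_seq x = x" "y \<in> closure (act_orbit (int_act shift) x)"
  shows "\<exists>m. dyadic_blocks k m y"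
proof -
  let ?S = "\<Union>m\<in>{0..<2 ^ k}. {y. dyadic_blocks k m y}"
  have "int_act shift g x \<in> ?S" for g
  proof -
    \<comment> \<open>Shifting by \<open>g\<close> moves the cut of \<open>x\<close> at 0 to
      \<open>- g\<close>, here reduced into the finite range.\<close>
    have "dyadic_blocks k ((- g) mod 2 ^ k + g) x"
      using Q_seq_fixed_dyadic_blocks[OF assms(1)]
      by (rule dyadic_blocks_cong_imp) (use dvd_minus_mod[of "2 ^ k" "- g"] in \<open>simp add: algebra_simps\<close>)
    then show ?thesis by (auto simp: dyadic_blocks_shift intro!: bexI[of _ "(- g) mod 2 ^ k"])
  qed
  then have "closure (act_orbit (int_act shift) x) \<subseteq> ?S"
    by (intro closure_minimal closed_UN ballI closed_dyadic_blocks) (auto simp: act_orbit_def)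
  with assms(2) show ?thesis by blast
qed

text \<open>The diagonal shift moves both offsets equally, so their difference modulo
  \<open>2 ^ k\<close> is constant along the orbit and, by the finite closed union
  \<open>?S\<close>, on its closure. A diagonal pair there would have two incongruent offsets,
  against uniqueness.\<close>

lemma different_blocks_off_diagonal:
  fixes y z :: "int \<Rightarrow> bool"
  assumes X: "closed X" "\<And>g x. x \<in> X \<Longrightarrow> int_act shift g x \<in> X" "y \<in> X" "z \<in> X"
    and ex: "\<And>u k. u \<in> X \<Longrightarrow> \<exists>m. dyadic_blocks k m u"
    and y: "dyadic_blocks k m y" and z: "dyadic_blocks k m' z" and neq: "\<not> 2 ^ k dvd m - m'"
  shows "closure (act_orbit (diag_act (int_act shift)) (y, z)) \<inter> Id = {}"
proof -
  let ?S = "\<Union>s\<in>{0..<2 ^ k}. {u. dyadic_blocks k (m + s) u} \<times> {v. dyadic_blocks k (m' + s) v}"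
  have "diag_act (int_act shift) g (y, z) \<in> ?S" for g
  proof -
    have "2 ^ k dvd i - (i + (- g) mod 2 ^ k + g)" for i
      using dvd_minus_mod[of "2 ^ k" "- g"] by (simp add: algebra_simps)
    then have "dyadic_blocks k (m + (- g) mod 2 ^ k + g) y"
      "dyadic_blocks k (m' + (- g) mod 2 ^ k + g) z"
      using y z by (blast intro: dyadic_blocks_cong_imp)+
    then show ?thesis
      by (auto simp: diag_act_def dyadic_blocks_shift intro!: bexI[of _ "(- g) mod 2 ^ k"])
  qed
  then have "closure (act_orbit (diag_act (int_act shift)) (y, z)) \<subseteq> ?S"
    by (intro closure_minimal closed_UN ballI closed_Times closed_dyadic_blocks)
      (auto simp: act_orbit_def)
  moreover have "(u, u) \<notin> ?S" if "u \<in> X" for u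
    using dyadic_blocks_unique[of u k, OF ex[OF that]] neq by fastforce
  moreover have "closure (act_orbit (diag_act (int_act shift)) (y, z)) \<subseteq> X \<times> X"
    using X by (rule closure_diag_orbit_subset)
  ultimately show ?thesis by blast
qed

text \<open>At every level the sequences are complementary on the common block containing a fixed
  point \<open>p\<close> of disagreement. Moving the origin well inside ever longer such blocks
  gives a complementary pair by compactness.\<close>

lemma same_blocks_complementary_limit:
  fixes y z :: "int \<Rightarrow> bool"
  assumes same: "\<And>k. \<exists>m. dyadic_blocks k m y \<and> dyadic_blocks k m z" and "y \<noteq> z"
  shows "closure (act_orbit (diag_act (int_act shift)) (y, z)) \<inter> {(u, v). \<forall>i. u i \<noteq> v i} \<noteq> {}"
proof -
  let ?O = "closure (act_orbit (diag_act (int_act shift)) (y, z))"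
  obtain p where p: "y p \<noteq> z p" using \<open>y \<noteq> z\<close> by blast
  have "compact (UNIV \<times> UNIV :: ((int \<Rightarrow> bool) \<times> (int \<Rightarrow> bool)) set)"
    by (intro compact_Times compact_UNIV_bool_sequences)
  then have comp: "compact ?O"
    by (metis UNIV_Times_UNIV Int_UNIV_left compact_Int_closed closed_closure)
  have fip: "?O \<inter> (\<Inter>i\<in>I. {w. fst w i \<noteq> snd w i}) \<noteq> {}" if fin: "finite I" for I
  proof -
    obtain N :: nat where N: "\<And>i. i \<in> I \<Longrightarrow> \<bar>i\<bar> < int N"
    proof
      fix i assume "i \<in> I"
      then show "\<bar>i\<bar> < int (nat (Max (abs ` I)) + 1)"
        using Max_ge[OF finite_imageI[OF fin] imageI, of i abs] by linarith
    qed
    have "int N < 2 ^ N" by (rule of_nat_less_two_power)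
    then have N2: "2 * int N < 2 ^ Suc N" by simp
    obtain m where m: "dyadic_blocks (Suc N) m y" "dyadic_blocks (Suc N) m z" using same by blast
    define q where "q = (p - m) div 2 ^ Suc N"
    have block: "y n \<noteq> z n" if "(n - m) div 2 ^ Suc N = q" for n
      using same_blocks_agree_iff[OF m, of n] same_blocks_agree_iff[OF m, of p] p that
      by (simp add: q_def)
    \<comment> \<open>\<open>c\<close> lies \<open>N\<close> places after the start of the block
      containing \<open>p\<close>. As \<open>2 * N < 2 ^ Suc N\<close>, all indices
      \<open>i + c\<close> with \<open>i\<close> in \<open>I\<close> stay in that block.\<close>
    define c where "c = m + 2 ^ Suc N * q + int N"
    have "y (i + c) \<noteq> z (i + c)" if "i \<in> I" for i
    proof (rule block)
      have "0 \<le> i + int N" "i + int N < 2 ^ Suc N" using N[OF that] N2 by linarith+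
      then have "(i + int N) div 2 ^ Suc N = 0" by (rule div_pos_pos_trivial)
      moreover have "i + c - m = i + int N + q * 2 ^ Suc N" by (simp add: c_def)
      moreover have "(i + int N + q * 2 ^ Suc N) div 2 ^ Suc N = q + (i + int N) div 2 ^ Suc N"
        by (rule div_mult_self1) simp
      ultimately show "(i + c - m) div 2 ^ Suc N = q" by (simp only: add_0_right)
    qed
    moreover have "diag_act (int_act shift) c (y, z) \<in> ?O"
      by (rule subsetD[OF closure_subset]) (simp add: act_orbit_def)
    moreover have "fst (diag_act (int_act shift) c (y, z)) i = y (i + c)"
      "snd (diag_act (int_act shift) c (y, z)) i = z (i + c)" for i
      by (simp_all add: diag_act_def int_act_shift)
    ultimately have "diag_act (int_act shift) c (y, z) \<in> ?O \<inter> (\<Inter>i\<in>I. {w. fst w i \<noteq> snd w i})"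
      by simp
    then show ?thesis by blast
  qed
  \<comment> \<open>Finite windows suffice, by the finite intersection property in the compact set
    \<open>?O\<close>.\<close>
  have "?O \<inter> (\<Inter>i. {w. fst w i \<noteq> snd w i}) \<noteq> {}"
    by (rule compact_imp_fip_image[OF comp closed_pairs_differing_at fip])
  moreover have "(\<Inter>i. {w. fst w i \<noteq> snd w i}) =
      {(u, v :: int \<Rightarrow> bool). \<forall>i. u i \<noteq> v i}" by auto
  ultimately show ?thesis by (simp only: not_False_eq_True)
qed

theorem mainTheorem1:
  fixes x :: "int \<Rightarrow> bool" and X :: "(int \<Rightarrow> bool) set"
  assumes "Q_seq x = x"
    and "X = closure (act_orbit (int_act shift) x)"
  shows "flow (int_act shift) X \<and> weakly_distal (int_act shift) X"
proof -
  let ?O = "\<lambda>z. closure (act_orbit (diag_act (int_act shift)) z)"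
  have "closed_invariant (int_act shift) X"
    unfolding assms(2)
    by (intro closed_invariant_closure_orbit continuous_on_int_act_shift int_act_shift_add)
  then have X: "closed X" "\<And>g x. x \<in> X \<Longrightarrow> int_act shift g x \<in> X"
    by (auto simp: closed_invariant_def)
  have ex: "\<exists>m. dyadic_blocks k m u" if "u \<in> X" for u k
    using orbit_closure_dyadic_blocks[OF assms(1)] that assms(2) by blast
  have "weakly_distal (int_act shift) X"
  proof (rule weakly_distal_shiftI[OF X])
    fix y z assume yz: "y \<in> X" "z \<in> X" "y \<noteq> z"
    have inv: "closed_invariant (diag_act (int_act shift)) (?O (y, z))"
      by (intro closed_invariant_closure_orbit continuous_on_diag_shift diag_shift_add)
    show "\<exists>N. closed_invariant (diag_act (int_act shift)) N \<and> N \<inter> Id = {} \<and> N \<subseteq> ?O (y, z)"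
    proof (cases "\<forall>k. \<exists>m. dyadic_blocks k m y \<and> dyadic_blocks k m z")
      case True
      \<comment> \<open>Complementarity is a closed and shift-invariant condition, so intersecting
        with \<open>?C\<close> yields the required invariant set.\<close>
      let ?C = "{(u, v). \<forall>i. u i \<noteq> v i} :: ((int \<Rightarrow> bool) \<times> (int \<Rightarrow> bool)) set"
      have "?C = (\<Inter>i. {w. fst w i \<noteq> snd w i})" by auto
      also have "closed \<dots>"
        by (intro closed_INT ballI closed_pairs_differing_at)
      finally have "closed ?C" .
      moreover have "?O (y, z) \<inter> ?C \<noteq> {}"
        using True yz(3) by (intro same_blocks_complementary_limit) auto
      moreover have "diag_act (int_act shift) g w \<in> ?O (y, z) \<inter> ?C" if "w \<in> ?O (y, z) \<inter> ?C" for g w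
      proof
        show "diag_act (int_act shift) g w \<in> ?O (y, z)"
          using inv that by (simp add: closed_invariant_def)
        show "diag_act (int_act shift) g w \<in> ?C"
          using that by (auto simp: diag_act_def int_act_shift)
      qed
      ultimately have "closed_invariant (diag_act (int_act shift)) (?O (y, z) \<inter> ?C)"
        by (simp add: closed_invariant_def closed_Int)
      then show ?thesis by (intro exI[of _ "?O (y, z) \<inter> ?C"]) auto
    next
      case False
      then obtain k where k: "\<And>m. \<not> (dyadic_blocks k m y \<and> dyadic_blocks k m z)" by blast
      obtain m m' where m: "dyadic_blocks k m y" "dyadic_blocks k m' z" using ex yz by metis
      \<comment> \<open>Congruent offsets would make \<open>m'\<close> a common offset of
        \<open>y\<close> and \<open>z\<close> at level \<open>k\<close>.\<close>
      then have "\<not> 2 ^ k dvd m - m'" using k dyadic_blocks_cong_imp by blast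
      then have "?O (y, z) \<inter> Id = {}"
        using different_blocks_off_diagonal[OF X yz(1,2) ex m] by blast
      with inv show ?thesis by blast
    qed
  qed
  with flow_shift[OF X] show ?thesis by blast
qed

end
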